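(* Let $0<s<1$, $2\le p<\infty$, $0<q<\infty$, $r\in\mathbb{R}$, $\rho\in[0,1]$, and let $\sigma:\mathbb{Z}\to\mathbb{C}$ satisfy the $\rho$-condition: there is $C>0$ such that $|\sigma(\xi)|\le C|\xi|^{-\rho}$ for all $\xi\in\mathbb{Z}\setminus\{0\}$. (i) If $r+1-\frac2p<\rho\le1$, then $\mathrm{Op}(\sigma)$ is a bounded linear operator from $B^{s}_{\infty,\infty}(\mathbb{T})$ into $B^{r}_{p,q}(\mathbb{T})$. (ii) If $r+1-\frac2p\le\rho\le1$, then $\mathrm{Op}(\sigma)$ is a bounded linear operator from $B^{s}_{\infty,\infty}(\mathbb{T})$ into $B^{r}_{p,\infty}(\mathbb{T})$.
   Context: $\mathbb{T}=[0,2\pi)$ is the one-dimensional torus with normalized Haar measure $dx$; $\widehat f(\xi)=\int_{\mathbb{T}}e^{-ix\xi}f(x)\,dx$ for $\xi\in\mathbb{Z}$, so that $f(x)=\sum_{\xi\in\mathbb{Z}}e^{ix\xi}\widehat f(\xi)$ for $f\in C^\infty(\mathbb{T})$. For $\sigma:\mathbb{Z}\to\mathbb{C}$, the Fourier multiplier is $\mathrm{Op}(\sigma)f(x)=\sum_{\xi\in\mathbb{Z}}e^{ix\xi}\sigma(\xi)\widehat f(\xi)$. Besov spaces: for $r\in\mathbb{R}$, $0<p\le\infty$, $0<q<\infty$, $$\|f\|_{B^r_{p,q}}=\Big(\sum_{m=0}^\infty 2^{mrq}\Big\|\sum_{2^m\le|\xi|<2^{m+1}}e^{ix\xi}\widehat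 f(\xi)\Big\|_{L^p(\mathbb{T})}^q\Big)^{1/q},$$ $$\|f\|_{B^r_{p,\infty}}=\sup_{m\ge 0}2^{mr}\Big\|\sum_{2^m\le|\xi|<2^{m+1}}e^{ix\xi}\widehat f(\xi)\Big\|_{L^p(\mathbb{T})}.$$ For $0<r<1$ the paper identifies $B^r_{\infty,\infty}(\mathbb{T})$ with the Hölder space $\Lambda^r(\mathbb{T})$ with norm $\|f\|_{\Lambda^r}=\sup_{x,\,y\neq 0}\frac{|f(x-y)-f(x)|}{|y|^r}+\sup_x|f(x)|$. Bounded from $X$ into $Y$ means: there is $C>0$ with $\|\mathrm{Op}(\sigma)f\|_Y\le C\|f\|_X$ for all $f\in C^\infty(\mathbb{T})$. *)

theory Defs
  imports "HOL-Probability.Essential_Supremum" "HOL-Analysis.Analysis"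
begin

text \<open>Functions on the torus are represented by functions on the real line (2 pi-periodic ones in
  the case of smooth functions); only their values on \<open>[0, 2\<pi>)\<close> are seen by this measure.\<close>

definition torus_measure :: "real measure" where
  "torus_measure = uniform_measure lborel {0..<2*pi}"

definition smooth_torus :: "(real \<Rightarrow> complex) set" where
  "smooth_torus = {f. (\<forall>x. f (x + 2*pi) = f x) \<and>
     (\<exists>D :: nat \<Rightarrow> real \<Rightarrow> complex. D 0 = f \<and>
       (\<forall>k x. (D k has_vector_derivative D (Suc k) x) (at x)))}"

definition fourier_coeff :: "(real \<Rightarrow> complex) \<Rightarrow> int \<Rightarrow> complex" where
  "fourier_coeff f \<xi> = (\<integral>x. cis (- (x * of_int \<xi>)) * f x \<partial>torus_measure)"

definition Op :: "(int \<Rightarrow> complex) \<Rightarrow> (real \<Rightarrow> complex) \<Rightarrow> real \<Rightarrow> complex" where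
  "Op \<sigma> f x = (\<Sum>\<^sub>\<infinity>\<xi>::int. cis (x * of_int \<xi>) * \<sigma> \<xi> * fourier_coeff f \<xi>)"

definition dyadic_block :: "nat \<Rightarrow> (real \<Rightarrow> complex) \<Rightarrow> real \<Rightarrow> complex" where
  "dyadic_block m f x =
     (\<Sum>\<xi> | 2 ^ m \<le> \<bar>\<xi>\<bar> \<and> \<bar>\<xi>\<bar> < 2 ^ Suc m. cis (x * of_int \<xi>) * fourier_coeff f \<xi>)"

text \<open>Norms take values in the extended nonnegative reals, so that a divergent sum, integral or
  supremum is \<open>\<infinity>\<close>. The following power is only meant for a positive exponent.\<close>

definition ennreal_powr :: "ennreal \<Rightarrow> real \<Rightarrow> ennreal" where
  "ennreal_powr x a = (if x = \<infinity> then \<infinity> else ennreal (enn2real x powr a))"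

definition Lp_norm :: "ennreal \<Rightarrow> (real \<Rightarrow> complex) \<Rightarrow> ennreal" where
  "Lp_norm p f =
     (if p = \<infinity> then esssup torus_measure (\<lambda>x. ennreal (cmod (f x)))
      else ennreal_powr (\<integral>\<^sup>+x. ennreal (cmod (f x) powr enn2real p) \<partial>torus_measure)
             (1 / enn2real p))"

text \<open>The blocks have sharp frequency cutoffs, and the zero frequency is not seen.\<close>

definition besov_norm :: "real \<Rightarrow> ennreal \<Rightarrow> ennreal \<Rightarrow> (real \<Rightarrow> complex) \<Rightarrow> ennreal" where
  "besov_norm r p q f =
     (if q = \<infinity> then (SUP m. ennreal (2 powr (real m * r)) * Lp_norm p (dyadic_block m f))
      else ennreal_powr
        (\<Sum>m. ennreal (2 powr (real m * r * enn2real q)) *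
               ennreal_powr (Lp_norm p (dyadic_block m f)) (enn2real q))
        (1 / enn2real q))"

text \<open>For \<open>0 < r < 1\<close> the space \<open>B\<^sup>r\<close> with both exponents infinite is identified with the Hoelder space.
  With sharp cutoffs the two norms are not equivalent, so both are used. By periodicity, letting
  \<open>y\<close> range over all nonzero reals gives the same supremum as \<open>0 < y < 2\<pi>\<close>.\<close>

definition hoelder_norm :: "real \<Rightarrow> (real \<Rightarrow> complex) \<Rightarrow> ennreal" where
  "hoelder_norm r f =
     (SUP x. SUP y\<in>-{0}. ennreal (cmod (f (x - y) - f x) / \<bar>y\<bar> powr r)) +
     (SUP x. ennreal (cmod (f x)))"

definition linear_on_smooth :: "((real \<Rightarrow> complex) \<Rightarrow> real \<Rightarrow> complex) \<Rightarrow> bool" where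
  "linear_on_smooth T \<longleftrightarrow>
     (\<forall>f\<in>smooth_torus. \<forall>g\<in>smooth_torus. \<forall>a b.
        T (\<lambda>x. a * f x + b * g x) = (\<lambda>x. a * T f x + b * T g x))"

definition bounded_linear_into ::
  "((real \<Rightarrow> complex) \<Rightarrow> ennreal) \<Rightarrow> ((real \<Rightarrow> complex) \<Rightarrow> ennreal) \<Rightarrow>
   ((real \<Rightarrow> complex) \<Rightarrow> real \<Rightarrow> complex) \<Rightarrow> bool" where
  "bounded_linear_into N\<^sub>X N\<^sub>Y T \<longleftrightarrow> linear_on_smooth T \<and>
     (\<exists>C::real. C > 0 \<and> (\<forall>f\<in>smooth_torus. N\<^sub>Y (T f) \<le> ennreal C * N\<^sub>X f))"

definition rho_condition :: "real \<Rightarrow> (int \<Rightarrow> complex) \<Rightarrow> bool" where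
  "rho_condition \<rho> \<sigma> \<longleftrightarrow>
     (\<exists>C::real. C > 0 \<and> (\<forall>\<xi>. \<xi> \<noteq> 0 \<longrightarrow> cmod (\<sigma> \<xi>) \<le> C * \<bar>of_int \<xi>\<bar> powr (- \<rho>)))"

end

theory Submission
  imports Defs "HOL-Probability.Probability_Measure"
begin

text \<open>The estimate rests on \<open>L\<^sup>2\<close>, where a Fourier multiplier is controlled by the size of its symbol alone.

  Let \<open>A\<close> be the norm of \<open>f\<close> in the source space. The part of \<open>f\<close> with frequencies \<open>2\<^bsup>m\<^esup> \<le> \<bar>\<xi>\<bar> < 2\<^bsup>m+1\<^esup>\<close> has
  \<open>L\<^sup>2\<close> norm at most \<open>2 A 2\<^bsup>-ms\<^esup>\<close>. For the Besov norm this holds because \<open>L\<^sup>2\<close> norms are bounded by \<open>L\<^sup>\<infinity>\<close>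
  norms (\<open>block_energy_control_besov\<close>); for the Hoelder norm it follows from Bessel's inequality for an
  increment of \<open>f\<close> with a step adapted to the block (\<open>block_energy_control_hoelder\<close>).

  The \<open>\<rho>\<close>-condition then bounds the \<open>L\<^sup>2\<close> norm of the block of \<open>Op \<sigma> f\<close> by a constant times
  \<open>A 2\<^bsup>-m(s+\<rho>)\<^esup>\<close>. As the block has about \<open>2\<^bsup>m\<^esup>\<close> frequencies, passing to \<open>L\<^sup>p\<close> costs a factor
  \<open>2\<^bsup>m(1/2-1/p)\<^esup>\<close> (\<open>trig_poly_Lp_le\<close>), so that the block decays like \<open>2\<^bsup>-mt\<^esup>\<close> with
  \<open>t = s + \<rho> - 1/2 + 1/p\<close> (\<open>Op_block_Lp_le\<close>). Since \<open>1/2 - 1/p \<le> 1 - 2/p\<close> for \<open>p \<ge> 2\<close>, either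
  hypothesis on \<open>r\<close> gives \<open>r \<le> \<rho> - (1/2 - 1/p) = t - s < t\<close>, and the weighted block norms are dominated
  by a geometric sequence (\<open>besov_norm_le_of_block_decay\<close>). This settles both target spaces.

  The blocks of \<open>Op \<sigma> f\<close> are defined by its own Fourier coefficients. That these are \<open>\<sigma> \<xi>\<close> times those of
  \<open>f\<close> is a consequence of absolute convergence, which holds because \<open>f\<close> is smooth and \<open>\<sigma>\<close> is bounded
  (\<open>fourier_coeff_Op\<close>).\<close>

section \<open>Integration over the torus\<close>

lemma prob_space_torus: "prob_space torus_measure"
  unfolding torus_measure_def by (rule prob_space_uniform_measure) auto

interpretation torus: prob_space torus_measure
  by (rule prob_space_torus)

lemma sets_torus [measurable_cong, simp]: "sets torus_measure = sets borel"
  by (simp add: torus_measure_def)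

lemma space_torus [simp]: "space torus_measure = UNIV"
  by (simp add: torus_measure_def)

lemma torus_measure_eq_density:
  "torus_measure = density lborel (\<lambda>x. ennreal (indicator {0..<2*pi} x / (2*pi)))"
proof -
  have "indicator {0..<2*pi} x / emeasure lborel {0..<2*pi} = ennreal (indicator {0..<2*pi} x / (2*pi))" for x
    by (cases "x \<in> {0..<2*pi}") (auto simp: divide_ennreal[symmetric])
  then show ?thesis by (simp add: torus_measure_def uniform_measure_def)
qed

lemma continuous_borel_measurable_torus:
  fixes g :: "real \<Rightarrow> 'b::{topological_space}"
  assumes "continuous_on UNIV g"
  shows "g \<in> borel_measurable torus_measure"
  using borel_measurable_continuous_onI[OF assms] by simp

lemma AE_torus: "AE x in torus_measure. x \<in> {0..2*pi}"
  unfolding torus_measure_def by (rule AE_uniform_measureI) auto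

lemma integrable_torus:
  fixes g :: "real \<Rightarrow> 'b::{banach, second_countable_topology}"
  assumes "continuous_on UNIV g"
  shows "integrable torus_measure g"
proof -
  have "compact (g ` {0..2*pi})"
    by (intro compact_continuous_image continuous_on_subset[OF assms]) auto
  then obtain B where "\<And>x. x \<in> {0..2*pi} \<Longrightarrow> norm (g x) \<le> B"
    using compact_imp_bounded bounded_iff by (metis imageI)
  then show ?thesis
    using AE_torus by (intro torus.integrable_const_bound[where B = B] continuous_borel_measurable_torus assms) auto
qed

lemma integral_torus:
  fixes g :: "real \<Rightarrow> complex"
  assumes "continuous_on UNIV g"
  shows "(\<integral>x. g x \<partial>torus_measure) = integral {0..2*pi} g /\<^sub>R (2*pi)"
proof -
  have gb: "g \<in> borel_measurable lborel"
    using borel_measurable_continuous_onI[OF assms] by simp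
  have "(\<integral>x. g x \<partial>torus_measure) = (\<integral>x. (indicator {0..<2*pi} x / (2*pi)) *\<^sub>R g x \<partial>lborel)"
    unfolding torus_measure_eq_density using gb by (subst integral_density) auto
  also have "\<dots> = (\<integral>x. indicator {0..2*pi} x *\<^sub>R g x /\<^sub>R (2*pi) \<partial>lborel)"
  proof (rule integral_cong_AE)
    show "AE x in lborel. (indicator {0..<2*pi} x / (2*pi)) *\<^sub>R g x = indicator {0..2*pi} x *\<^sub>R g x /\<^sub>R (2*pi)"
      using AE_lborel_singleton[of "2*pi"]
      by eventually_elim (auto simp: indicator_def divide_simps)
  qed (use gb in measurable)
  also have "\<dots> = (LINT x:{0..2*pi}|lborel. g x) /\<^sub>R (2*pi)"
    by (simp only: set_lebesgue_integral_def integral_scaleR_right)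
  also have "(LINT x:{0..2*pi}|lborel. g x) = integral {0..2*pi} g"
    by (intro set_borel_integral_eq_integral borel_integrable_atLeastAtMost' continuous_on_subset[OF assms]) auto
  finally show ?thesis .
qed

lemma cis_has_vector_derivative:
  "((\<lambda>x. cis (x * a)) has_vector_derivative \<i> * a * cis (x * a)) (at x within S)"
proof -
  have "((\<lambda>z. exp (\<i> * (z * of_real a))) has_field_derivative \<i> * a * exp (\<i> * (of_real x * of_real a))) (at (of_real x))"
    by (auto intro!: derivative_eq_intros)
  from has_vector_derivative_real_field[OF this] show ?thesis
    by (simp add: cis_conv_exp)
qed

lemma integral_torus_cis:
  "(\<integral>x. cis (x * of_int n) \<partial>torus_measure) = (if n = 0 then 1 else 0)"
proof (cases "n = 0")
  case True
  then show ?thesis using torus.prob_space by simp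
next
  case False
  have "((\<lambda>x. cis (x * of_int n)) has_integral
      (cis (2*pi * of_int n) / (\<i> * of_int n) - cis (0 * of_int n) / (\<i> * of_int n))) {0..2*pi}"
  proof (rule fundamental_theorem_of_calculus)
    fix x :: real
    show "((\<lambda>x. cis (x * of_int n) / (\<i> * of_int n)) has_vector_derivative cis (x * of_int n)) (at x within {0..2*pi})"
      using has_vector_derivative_mult_right[OF cis_has_vector_derivative[of "of_int n"], of "1 / (\<i> * of_int n)"] False
      by simp
  qed auto
  moreover have "cis (2*pi * of_int n) = 1"
    using cis_multiple_2pi[of "of_int n"] by simp
  ultimately have "integral {0..2*pi} (\<lambda>x. cis (x * of_int n)) = 0"
    by (auto dest: integral_unique)
  then show ?thesis using False
    by (subst integral_torus) (auto intro!: continuous_intros)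
qed

section \<open>Fourier coefficients and trigonometric polynomials\<close>

lemma fourier_coeff_add:
  assumes "continuous_on UNIV f" "continuous_on UNIV g"
  shows "fourier_coeff (\<lambda>x. f x + g x) \<xi> = fourier_coeff f \<xi> + fourier_coeff g \<xi>"
  unfolding fourier_coeff_def ring_distribs
  by (intro Bochner_Integration.integral_add integrable_torus continuous_intros assms)

lemma fourier_coeff_diff:
  assumes "continuous_on UNIV f" "continuous_on UNIV g"
  shows "fourier_coeff (\<lambda>x. f x - g x) \<xi> = fourier_coeff f \<xi> - fourier_coeff g \<xi>"
  unfolding fourier_coeff_def ring_distribs
  by (intro Bochner_Integration.integral_diff integrable_torus continuous_intros assms)

lemma fourier_coeff_cmult: "fourier_coeff (\<lambda>x. c * f x) \<xi> = c * fourier_coeff f \<xi>"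
proof -
  have "(\<lambda>x. cis (- (x * of_int \<xi>)) * (c * f x)) = (\<lambda>x. c * (cis (- (x * of_int \<xi>)) * f x))"
    by (simp add: ac_simps)
  then show ?thesis by (simp add: fourier_coeff_def)
qed

lemma norm_integral_torus_le:
  fixes g :: "real \<Rightarrow> complex"
  assumes "continuous_on UNIV g" and "\<And>x. x \<in> {0..2*pi} \<Longrightarrow> norm (g x) \<le> B"
  shows "norm (\<integral>x. g x \<partial>torus_measure) \<le> B"
proof -
  have i: "integrable torus_measure g" by (rule integrable_torus[OF assms(1)])
  have "norm (\<integral>x. g x \<partial>torus_measure) \<le> (\<integral>x. norm (g x) \<partial>torus_measure)"
    by (rule integral_norm_bound)
  also have "\<dots> \<le> (\<integral>x. B \<partial>torus_measure)"
    using AE_torus by (intro integral_mono_AE) (use i assms in auto)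
  also have "\<dots> = B" by (simp add: torus.prob_space[simplified])
  finally show ?thesis .
qed

lemma norm_fourier_coeff_le:
  assumes "continuous_on UNIV f" and "\<And>x. x \<in> {0..2*pi} \<Longrightarrow> norm (f x) \<le> B"
  shows "norm (fourier_coeff f \<xi>) \<le> B"
  unfolding fourier_coeff_def
  by (rule norm_integral_torus_le) (use assms in \<open>auto intro!: continuous_intros simp: norm_mult\<close>)

definition trig_poly :: "int set \<Rightarrow> (int \<Rightarrow> complex) \<Rightarrow> real \<Rightarrow> complex" where
  "trig_poly F c x = (\<Sum>\<xi>\<in>F. cis (x * of_int \<xi>) * c \<xi>)"

lemma continuous_trig_poly [continuous_intros]: "continuous_on UNIV (trig_poly F c)"
  unfolding trig_poly_def by (intro continuous_intros)

lemma char_mult: "cis (x * of_int (\<xi> - \<eta>)) = cis (- (x * of_int \<eta>)) * cis (x * of_int \<xi>)"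
  unfolding cis_mult by (simp add: right_diff_distrib)

lemma fourier_coeff_trig_poly:
  assumes "finite F"
  shows "fourier_coeff (trig_poly F c) \<eta> = (if \<eta> \<in> F then c \<eta> else 0)"
proof -
  have "fourier_coeff (trig_poly F c) \<eta> = (\<integral>x. (\<Sum>\<xi>\<in>F. c \<xi> * cis (x * of_int (\<xi> - \<eta>))) \<partial>torus_measure)"
    unfolding fourier_coeff_def trig_poly_def sum_distrib_left
    by (intro Bochner_Integration.integral_cong refl sum.cong)
       (subst char_mult, simp add: ac_simps)
  also have "\<dots> = (\<Sum>\<xi>\<in>F. c \<xi> * (\<integral>x. cis (x * of_int (\<xi> - \<eta>)) \<partial>torus_measure))"
    by (subst Bochner_Integration.integral_sum) (auto intro!: integrable_torus continuous_intros simp del: of_int_diff)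
  also have "\<dots> = (\<Sum>\<xi>\<in>F. if \<xi> = \<eta> then c \<xi> else 0)"
    unfolding integral_torus_cis by (intro sum.cong) auto
  finally show ?thesis using assms by simp
qed

lemma integral_cnj_trig_poly_mult:
  assumes "continuous_on UNIV g"
  shows "(\<integral>x. cnj (trig_poly F c x) * g x \<partial>torus_measure) = (\<Sum>\<xi>\<in>F. cnj (c \<xi>) * fourier_coeff g \<xi>)"
proof -
  have "(\<lambda>x. cnj (trig_poly F c x) * g x) = (\<lambda>x. \<Sum>\<xi>\<in>F. cnj (c \<xi>) * (cis (- (x * of_int \<xi>)) * g x))"
    by (auto simp: trig_poly_def cis_cnj sum_distrib_right intro!: sum.cong)
  then show ?thesis unfolding fourier_coeff_def
    by (simp add: Bochner_Integration.integral_sum integrable_torus continuous_intros assms)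
qed

lemma trig_poly_parseval:
  assumes "finite F"
  shows "(\<integral>x. (cmod (trig_poly F c x))\<^sup>2 \<partial>torus_measure) = (\<Sum>\<xi>\<in>F. (cmod (c \<xi>))\<^sup>2)"
proof -
  have "complex_of_real (\<integral>x. (cmod (trig_poly F c x))\<^sup>2 \<partial>torus_measure)
      = (\<integral>x. cnj (trig_poly F c x) * trig_poly F c x \<partial>torus_measure)"
    by (simp only: integral_complex_of_real[symmetric] complex_norm_square mult.commute)
  also have "\<dots> = (\<Sum>\<xi>\<in>F. cnj (c \<xi>) * c \<xi>)"
    by (simp add: integral_cnj_trig_poly_mult continuous_trig_poly fourier_coeff_trig_poly assms)
  also have "\<dots> = complex_of_real (\<Sum>\<xi>\<in>F. (cmod (c \<xi>))\<^sup>2)"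
    by (simp only: of_real_sum complex_norm_square mult.commute)
  finally show ?thesis by (simp only: of_real_eq_iff)
qed

text \<open>Expand \<open>0 \<le> \<integral>\<bar>g - S\<bar>\<^sup>2\<close>, where \<open>S\<close> is the partial Fourier sum of \<open>g\<close> over \<open>F\<close>: both the cross term
  \<open>\<langle>g, S\<rangle>\<close> and \<open>\<integral>\<bar>S\<bar>\<^sup>2\<close> equal the sum of squares on the left-hand side.\<close>

lemma bessel_inequality:
  assumes "finite F" "continuous_on UNIV g"
  shows "(\<Sum>\<xi>\<in>F. (cmod (fourier_coeff g \<xi>))\<^sup>2) \<le> (\<integral>x. (cmod (g x))\<^sup>2 \<partial>torus_measure)"
proof -
  define S where "S = trig_poly F (fourier_coeff g)"
  define E where "E = (\<Sum>\<xi>\<in>F. (cmod (fourier_coeff g \<xi>))\<^sup>2)"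
  have cS: "continuous_on UNIV S" unfolding S_def by (rule continuous_trig_poly)
  have sq: "cmod (u - v) ^ 2 = Re (cnj u * u) - 2 * Re (cnj v * u) + Re (cnj v * v)" for u v :: complex
    unfolding cmod_power2 by (simp add: power2_eq_square algebra_simps)
  have sq0: "cmod u ^ 2 = Re (cnj u * u)" for u
    unfolding cmod_power2 by (simp add: power2_eq_square)
  have i: "integrable torus_measure (\<lambda>x. cnj (g x) * g x)" "integrable torus_measure (\<lambda>x. cnj (S x) * g x)"
    "integrable torus_measure (\<lambda>x. cnj (S x) * S x)"
    by (intro integrable_torus continuous_intros assms cS)+
  have inner: "(\<integral>x. cnj (S x) * g x \<partial>torus_measure) = of_real E"
    unfolding S_def E_def integral_cnj_trig_poly_mult[OF assms(2)] of_real_sum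
    by (simp only: complex_norm_square mult.commute)
  have "0 \<le> (\<integral>x. (cmod (g x - S x))\<^sup>2 \<partial>torus_measure)" by simp
  also have "\<dots> = (\<integral>x. Re (cnj (g x) * g x) \<partial>torus_measure) - 2 * (\<integral>x. Re (cnj (S x) * g x) \<partial>torus_measure)
      + (\<integral>x. Re (cnj (S x) * S x) \<partial>torus_measure)"
    unfolding sq using i[THEN integrable_Re]
    by (simp add: Bochner_Integration.integral_add Bochner_Integration.integral_diff del: times_complex.sel)
  also have "(\<integral>x. Re (cnj (S x) * g x) \<partial>torus_measure) = E"
    using integral_Re[OF i(2)] inner by simp
  also have "(\<integral>x. Re (cnj (S x) * S x) \<partial>torus_measure) = E"
    unfolding sq0[symmetric] S_def E_def by (rule trig_poly_parseval[OF assms(1)])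
  finally have "E \<le> (\<integral>x. Re (cnj (g x) * g x) \<partial>torus_measure)" by linarith
  then show ?thesis unfolding E_def sq0 .
qed

section \<open>Smooth functions have absolutely summable Fourier coefficients\<close>

lemma periodic_has_vector_derivative:
  fixes f :: "real \<Rightarrow> 'a::real_normed_vector"
  assumes "\<And>x. f (x + T) = f x" and "\<And>x. (f has_vector_derivative f' x) (at x)"
  shows "f' (x + T) = f' x"
proof -
  have "((f \<circ> (\<lambda>x. x + T)) has_vector_derivative 1 *\<^sub>R f' (x + T)) (at x)"
    by (rule vector_diff_chain_at) (auto intro!: derivative_eq_intros assms)
  then have "(f has_vector_derivative f' (x + T)) (at x)"
    by (simp add: o_def assms(1))
  then show ?thesis using assms(2) vector_derivative_unique_at by blast
qed

text \<open>Integration by parts: the boundary term vanishes by periodicity.\<close>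

lemma fourier_coeff_deriv:
  assumes "\<And>x. f (x + 2*pi) = f x" and d: "\<And>x. (f has_vector_derivative f' x) (at x)"
    and c: "continuous_on UNIV f'"
  shows "fourier_coeff f' \<xi> = \<i> * of_int \<xi> * fourier_coeff f \<xi>"
proof -
  define e where "e x = cis (- (x * of_int \<xi>))" for x
  have e: "(e has_vector_derivative - (\<i> * of_int \<xi>) * e x) (at x)" for x
    using cis_has_vector_derivative[of "- of_int \<xi>" x UNIV] by (simp add: e_def[abs_def])
  have cf: "continuous_on UNIV f"
    using d by (intro continuous_at_imp_continuous_on) (auto intro: has_vector_derivative_continuous)
  have ce: "continuous_on UNIV e"
    unfolding e_def by (intro continuous_intros)
  have "((\<lambda>x. e x * f' x + (- (\<i> * of_int \<xi>) * e x) * f x) has_integral e (2*pi) * f (2*pi) - e 0 * f 0) {0..2*pi}"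
  proof (rule fundamental_theorem_of_calculus)
    show "((\<lambda>x. e x * f x) has_vector_derivative e x * f' x + (- (\<i> * of_int \<xi>) * e x) * f x) (at x within {0..2*pi})" for x
      by (rule has_vector_derivative_at_within[OF has_vector_derivative_mult[OF e d]])
  qed auto
  moreover have "e (2*pi) = 1"
    using cis_multiple_2pi[of "- of_int \<xi>"] by (simp add: e_def)
  moreover have "f (2*pi) = f 0" using assms(1)[of 0] by simp
  ultimately have "integral {0..2*pi} (\<lambda>x. e x * f' x - (\<i> * of_int \<xi>) * (e x * f x)) = 0"
    by (auto dest!: integral_unique simp: e_def mult.assoc)
  then have "(\<integral>x. e x * f' x - (\<i> * of_int \<xi>) * (e x * f x) \<partial>torus_measure) = 0"
    by (subst integral_torus) (auto intro!: continuous_intros ce c cf)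
  moreover have "(\<integral>x. e x * f' x - (\<i> * of_int \<xi>) * (e x * f x) \<partial>torus_measure)
     = fourier_coeff f' \<xi> - (\<i> * of_int \<xi>) * fourier_coeff f \<xi>"
    unfolding fourier_coeff_def e_def[symmetric]
    by (subst Bochner_Integration.integral_diff)
      (auto intro!: integrable_torus continuous_intros ce c cf)
  ultimately show ?thesis by simp
qed

lemma smooth_torusE:
  assumes "f \<in> smooth_torus"
  obtains D where "D 0 = f" "\<And>k x. (D k has_vector_derivative D (Suc k) x) (at x)"
    "\<And>k. continuous_on UNIV (D k)" "\<And>k x. D k (x + 2*pi) = D k x"
proof -
  from assms obtain D where D: "D 0 = f" "\<And>k x. (D k has_vector_derivative D (Suc k) x) (at x)"
    and p: "\<And>x. f (x + 2*pi) = f x"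
    unfolding smooth_torus_def by blast
  have "continuous_on UNIV (D k)" for k
    using D(2) by (intro continuous_at_imp_continuous_on) (auto intro: has_vector_derivative_continuous)
  moreover have "D k (x + 2*pi) = D k x" for k x
  proof (induction k arbitrary: x)
    case 0
    then show ?case by (simp add: D p)
  next
    case (Suc k)
    then show ?case by (rule periodic_has_vector_derivative) (rule D)
  qed
  ultimately show thesis using that D by blast
qed

lemma continuous_smooth_torus: "f \<in> smooth_torus \<Longrightarrow> continuous_on UNIV f"
  by (elim smooth_torusE) metis

lemma periodic_smooth_torus: "f \<in> smooth_torus \<Longrightarrow> f (x + 2*pi) = f x"
  by (auto simp: smooth_torus_def)

lemma bounded_fourier_coeff:
  assumes "continuous_on UNIV f"
  obtains B where "B \<ge> 0" "\<And>\<xi>. norm (fourier_coeff f \<xi>) \<le> B"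
proof -
  have "compact (f ` {0..2*pi})"
    by (intro compact_continuous_image continuous_on_subset[OF assms]) auto
  then obtain B where "\<And>x. x \<in> {0..2*pi} \<Longrightarrow> norm (f x) \<le> B"
    using compact_imp_bounded bounded_iff by (metis imageI)
  then have "norm (fourier_coeff f \<xi>) \<le> B" for \<xi>
    by (intro norm_fourier_coeff_le assms)
  moreover from this[of 0] have "B \<ge> 0" using norm_ge_zero order_trans by blast
  ultimately show thesis using that by blast
qed

lemma summable_on_inverse_Suc_square_int: "(\<lambda>\<xi>::int. 1 / (1 + (of_int \<xi>)\<^sup>2) :: real) summable_on UNIV"
proof -
  let ?g = "\<lambda>\<xi>::int. 1 / (1 + (of_int \<xi>)\<^sup>2) :: real"
  have "summable (\<lambda>n. 1 / (real n)\<^sup>2)"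
    using inverse_power_summable[of 2, where ?'a = real] by (simp add: inverse_eq_divide)
  then have "summable (\<lambda>n. norm (1 / (1 + (real n)\<^sup>2)))"
    by (rule summable_comparison_test'[where N = 1]) (auto simp: field_simps add_pos_nonneg)
  then have nat: "(\<lambda>n. 1 / (1 + (real n)\<^sup>2)) summable_on UNIV"
    by (rule norm_summable_imp_summable_on)
  have "?g summable_on {0..}"
    using nat by (subst summable_on_reindex_bij_witness[of _ int nat UNIV]) auto
  moreover have "?g summable_on {..<0}"
  proof -
    have "(\<lambda>n. 1 / (1 + (real n)\<^sup>2)) summable_on {1..}"
      by (rule summable_on_subset_banach[OF nat]) auto
    then show ?thesis
      by (subst summable_on_reindex_bij_witness[of _ "\<lambda>n. - int n" "\<lambda>k. nat (- k)" "{1..}"]) auto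
  qed
  ultimately have "?g summable_on ({0..} \<union> {..<0})"
    by (rule summable_on_Un_disjoint) auto
  moreover have "{0..} \<union> {..<0} = (UNIV :: int set)" by auto
  ultimately show ?thesis by simp
qed

text \<open>The coefficients of \<open>f\<close> and of its second derivative are bounded, and the latter are \<open>- \<xi>\<^sup>2\<close> times
  the former. Hence the coefficients of \<open>f\<close> are \<open>O(1 / (1 + \<xi>\<^sup>2))\<close>.\<close>

lemma summable_fourier_coeff:
  assumes "f \<in> smooth_torus"
  shows "(\<lambda>\<xi>. norm (fourier_coeff f \<xi>)) summable_on UNIV"
proof -
  from assms obtain D where D: "D 0 = f" "\<And>k x. (D k has_vector_derivative D (Suc k) x) (at x)"
    "\<And>k. continuous_on UNIV (D k)" "\<And>k x. D k (x + 2*pi) = D k x" by (rule smooth_torusE) blast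
  have step: "fourier_coeff (D (Suc k)) \<xi> = \<i> * of_int \<xi> * fourier_coeff (D k) \<xi>" for k \<xi>
    by (rule fourier_coeff_deriv) (use D in auto)
  have D2: "norm (fourier_coeff (D 2) \<xi>) = (of_int \<xi>)\<^sup>2 * norm (fourier_coeff f \<xi>)" for \<xi>
    using step[of 1 \<xi>] step[of 0 \<xi>] by (simp add: numeral_2_eq_2 D norm_mult power2_eq_square)
  obtain B0 where B0: "B0 \<ge> 0" "\<And>\<xi>. norm (fourier_coeff f \<xi>) \<le> B0"
    using bounded_fourier_coeff[OF D(3)[of 0]] D(1) by auto
  obtain B2 where B2: "B2 \<ge> 0" "\<And>\<xi>. norm (fourier_coeff (D 2) \<xi>) \<le> B2"
    using bounded_fourier_coeff[OF D(3)[of 2]] by auto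
  have "norm (fourier_coeff f \<xi>) \<le> (B0 + B2) * (1 / (1 + (of_int \<xi>)\<^sup>2))" for \<xi>
  proof -
    have "norm (fourier_coeff f \<xi>) * (1 + (of_int \<xi>)\<^sup>2) \<le> B0 + B2"
      using B0(2)[of \<xi>] B2(2)[of \<xi>] unfolding D2 by (simp add: algebra_simps)
    moreover have "1 + (of_int \<xi>)\<^sup>2 > (0::real)" by (simp add: add_pos_nonneg)
    ultimately show ?thesis by (simp add: pos_le_divide_eq)
  qed
  then show ?thesis
    by (intro Infinite_Sum.abs_summable_on_comparison_test'[OF summable_on_cmult_right[OF summable_on_inverse_Suc_square_int]])
qed

text \<open>The series converges uniformly, and taking a Fourier coefficient is continuous for the supremum
  norm, so it suffices to know the coefficients of the finite partial sums.\<close>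

lemma fourier_coeff_absolutely_convergent:
  fixes c :: "int \<Rightarrow> complex"
  assumes "(\<lambda>\<xi>. norm (c \<xi>)) summable_on UNIV"
  shows "fourier_coeff (\<lambda>x. \<Sum>\<^sub>\<infinity>\<xi>. cis (x * of_int \<xi>) * c \<xi>) \<eta> = c \<eta>"
proof -
  define S where "S = (\<lambda>x. \<Sum>\<^sub>\<infinity>\<xi>. cis (x * of_int \<xi>) * c \<xi>)"
  have lim: "uniform_limit UNIV (\<lambda>F. trig_poly F c) S (finite_subsets_at_top UNIV)"
    unfolding S_def trig_poly_def
    by (rule Weierstrass_m_test_general[OF _ assms]) (simp add: norm_mult)
  have cS: "continuous_on UNIV S"
    by (rule uniform_limit_theorem[OF _ lim]) (auto intro!: always_eventually continuous_intros)
  have "norm (fourier_coeff S \<eta> - c \<eta>) \<le> e" if "e > 0" for e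
  proof -
    have "eventually (\<lambda>F. finite F \<and> {\<eta>} \<subseteq> F) (finite_subsets_at_top (UNIV::int set))"
      by (auto simp: eventually_finite_subsets_at_top)
    with uniform_limitD[OF lim that]
    have "eventually (\<lambda>F. norm (fourier_coeff S \<eta> - c \<eta>) \<le> e) (finite_subsets_at_top (UNIV::int set))"
    proof eventually_elim
      case (elim F)
      then have "fourier_coeff S \<eta> - c \<eta> = fourier_coeff (\<lambda>x. S x - trig_poly F c x) \<eta>"
        by (simp add: fourier_coeff_diff cS continuous_trig_poly fourier_coeff_trig_poly)
      also have "norm \<dots> \<le> e"
        using elim by (intro norm_fourier_coeff_le continuous_intros cS) (auto simp: dist_norm norm_minus_commute less_imp_le)
      finally show ?case .
    qed
    then show ?thesis by (simp add: eventually_const)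
  qed
  then have "norm (fourier_coeff S \<eta> - c \<eta>) \<le> 0" by (rule field_le_epsilon[of _ 0, simplified])
  then show ?thesis by (simp add: S_def)
qed

section \<open>Translations\<close>

lemma integral_torus_shift:
  fixes g :: "real \<Rightarrow> complex"
  assumes c: "continuous_on UNIV g" and p: "\<And>x. g (x + 2*pi) = g x" and h: "0 \<le> h" "h \<le> 2*pi"
  shows "(\<integral>x. g (x - h) \<partial>torus_measure) = (\<integral>x. g x \<partial>torus_measure)"
proof -
  have i: "g integrable_on {a..b}" for a b
    by (intro integrable_continuous_real continuous_on_subset[OF c]) auto
  have "(\<lambda>x. g (x - h)) = g \<circ> ((+) (- h))" by auto
  then have "integral {0..2*pi} (\<lambda>x. g (x - h)) = integral {- h..2*pi - h} g"
    using integral_shift_Icc_real[of 0 "2*pi" g "-h"] by simp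
  also have "\<dots> = integral {- h..0} g + integral {0..2*pi - h} g"
    by (rule Henstock_Kurzweil_Integration.integral_combine[symmetric]) (use h i in auto)
  also have "integral {- h..0} g = integral {2*pi - h..2*pi} g"
    using integral_shift_Icc_real[of "-h" 0 g "2*pi"] by (simp add: o_def p add.commute)
  also have "integral {2*pi - h..2*pi} g + integral {0..2*pi - h} g = integral {0..2*pi} g"
    by (subst add.commute, rule Henstock_Kurzweil_Integration.integral_combine) (use h i in auto)
  finally show ?thesis
    using c by (subst (1 2) integral_torus) (auto intro!: continuous_on_compose2[OF c] continuous_intros)
qed

lemma fourier_coeff_shift:
  assumes c: "continuous_on UNIV f" and p: "\<And>x. f (x + 2*pi) = f x" and h: "0 \<le> h" "h \<le> 2*pi"
  shows "fourier_coeff (\<lambda>x. f (x - h)) \<xi> = cis (- (h * of_int \<xi>)) * fourier_coeff f \<xi>"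
proof -
  define g where "g x = cis (- (x * of_int \<xi>)) * f x" for x
  have "cis (- ((x + 2*pi) * of_int \<xi>)) = cis (- (x * of_int \<xi>))" for x
  proof -
    have "cis (- ((x + 2*pi) * of_int \<xi>)) = cis (- (x * of_int \<xi>)) * cis (2 * pi * of_int (- \<xi>))"
      unfolding cis_mult by (simp add: algebra_simps)
    then show ?thesis using cis_multiple_2pi[of "of_int (- \<xi>)"] by simp
  qed
  then have "(\<integral>x. g (x - h) \<partial>torus_measure) = fourier_coeff f \<xi>"
    unfolding fourier_coeff_def g_def[symmetric]
    by (intro integral_torus_shift h) (auto simp: g_def p intro!: continuous_intros c)
  moreover have "cis (- (x * of_int \<xi>)) * f (x - h) = cis (- (h * of_int \<xi>)) * g (x - h)" for x
    unfolding g_def mult.assoc[symmetric] cis_mult by (simp add: algebra_simps)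
  ultimately show ?thesis by (simp add: fourier_coeff_def)
qed

section \<open>The multiplier on the Fourier side\<close>

lemma summable_symbol_times_fourier_coeff:
  assumes "rho_condition \<rho> \<sigma>" "0 \<le> \<rho>" "f \<in> smooth_torus"
  shows "(\<lambda>\<xi>. norm (\<sigma> \<xi> * fourier_coeff f \<xi>)) summable_on UNIV"
proof -
  from assms obtain C where C: "C > 0" "\<And>\<xi>. \<xi> \<noteq> 0 \<Longrightarrow> cmod (\<sigma> \<xi>) \<le> C * \<bar>of_int \<xi>\<bar> powr (- \<rho>)"
    unfolding rho_condition_def by blast
  have "cmod (\<sigma> \<xi>) \<le> max C (cmod (\<sigma> 0))" for \<xi>
  proof (cases "\<xi> = 0")
    case False
    then have "\<bar>of_int \<xi>\<bar> \<ge> (1::real)" by linarith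
    then have "\<bar>of_int \<xi>\<bar> powr (- \<rho>) \<le> (1::real)"
      using powr_mono[of "-\<rho>" 0 "\<bar>of_int \<xi>\<bar>"] assms(2) False by simp
    then have "C * \<bar>of_int \<xi>\<bar> powr (- \<rho>) \<le> C" using C(1) by (simp add: mult_left_le)
    then show ?thesis using C(2)[OF False] by simp
  qed simp
  then have "norm (\<sigma> \<xi> * fourier_coeff f \<xi>) \<le> max C (cmod (\<sigma> 0)) * norm (fourier_coeff f \<xi>)" for \<xi>
    by (simp add: norm_mult mult_right_mono)
  then show ?thesis
    by (intro Infinite_Sum.abs_summable_on_comparison_test'[OF summable_on_cmult_right[OF summable_fourier_coeff[OF assms(3)]]])
qed

lemma fourier_coeff_Op:
  assumes "rho_condition \<rho> \<sigma>" "0 \<le> \<rho>" "f \<in> smooth_torus"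
  shows "fourier_coeff (Op \<sigma> f) \<xi> = \<sigma> \<xi> * fourier_coeff f \<xi>"
  using fourier_coeff_absolutely_convergent[OF summable_symbol_times_fourier_coeff[OF assms], of \<xi>]
  by (simp add: Op_def[abs_def] mult.assoc)

text \<open>Linearity needs an argument because an infinite sum is additive only on summable families.\<close>

lemma linear_on_smooth_Op:
  assumes "rho_condition \<rho> \<sigma>" "0 \<le> \<rho>"
  shows "linear_on_smooth (Op \<sigma>)"
  unfolding linear_on_smooth_def
proof (intro ballI allI ext)
  fix f g a b x assume fg: "f \<in> smooth_torus" "g \<in> smooth_torus"
  define u where "u f \<xi> = cis (x * of_int \<xi>) * \<sigma> \<xi> * fourier_coeff f \<xi>" for f \<xi>
  have su: "u f summable_on UNIV" if "f \<in> smooth_torus" for f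
  proof (rule abs_summable_summable)
    show "(\<lambda>\<xi>. norm (u f \<xi>)) summable_on UNIV"
      using summable_symbol_times_fourier_coeff[OF assms that] by (simp add: u_def norm_mult)
  qed
  have "fourier_coeff (\<lambda>x. a * f x + b * g x) \<xi> = a * fourier_coeff f \<xi> + b * fourier_coeff g \<xi>" for \<xi>
    by (simp add: fourier_coeff_add fourier_coeff_cmult continuous_intros continuous_smooth_torus fg)
  then have "u (\<lambda>x. a * f x + b * g x) \<xi> = a * u f \<xi> + b * u g \<xi>" for \<xi>
    by (simp add: u_def algebra_simps)
  then have "infsum (u (\<lambda>x. a * f x + b * g x)) UNIV = (\<Sum>\<^sub>\<infinity>\<xi>. a * u f \<xi> + b * u g \<xi>)"
    by presburger
  also have "\<dots> = a * infsum (u f) UNIV + b * infsum (u g) UNIV"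
    by (simp add: infsum_add infsum_cmult_right' summable_on_cmult_right su fg)
  finally show "Op \<sigma> (\<lambda>x. a * f x + b * g x) x = a * Op \<sigma> f x + b * Op \<sigma> g x"
    by (simp add: Op_def u_def[abs_def])
qed

section \<open>Dyadic blocks\<close>

definition freq_block :: "nat \<Rightarrow> int set" where
  "freq_block m = {\<xi>. 2 ^ m \<le> \<bar>\<xi>\<bar> \<and> \<bar>\<xi>\<bar> < 2 ^ Suc m}"

lemma dyadic_block_eq_trig_poly: "dyadic_block m f = trig_poly (freq_block m) (fourier_coeff f)"
  by (simp add: dyadic_block_def trig_poly_def freq_block_def fun_eq_iff)

lemma freq_block_eq: "freq_block m = {2 ^ m..<2 ^ Suc m} \<union> uminus ` {2 ^ m..<2 ^ Suc m}"
proof -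
  have "\<xi> \<in> uminus ` {2 ^ m..<2 ^ Suc m}" if "2 ^ m \<le> - \<xi>" "- \<xi> < 2 ^ Suc m" for \<xi> :: int
    using that by (intro image_eqI[of _ _ "- \<xi>"]) auto
  moreover have "(2::int) ^ m > 0" by simp
  ultimately show ?thesis
    by (auto simp: freq_block_def abs_if not_less split: if_splits)
qed

lemma finite_freq_block [simp]: "finite (freq_block m)"
  by (simp add: freq_block_eq)

lemma card_freq_block_le: "real (card (freq_block m)) \<le> 2 ^ Suc m"
proof -
  have "card (freq_block m) \<le> card {2 ^ m..<(2::int) ^ Suc m} + card {2 ^ m..<(2::int) ^ Suc m}"
    unfolding freq_block_eq by (rule order_trans[OF card_Un_le]) (intro add_mono card_image_le order_refl, simp)
  also have "\<dots> = 2 ^ Suc m" by (simp add: nat_power_eq)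
  finally show ?thesis
    using of_nat_mono by fastforce
qed

lemma ennreal_powr_le:
  assumes "x \<le> ennreal y" "0 \<le> y" "0 \<le> a"
  shows "ennreal_powr x a \<le> ennreal (y powr a)"
proof -
  have "x \<noteq> \<infinity>" using assms(1) by (auto simp: top_unique)
  moreover have "enn2real x \<le> y" using assms by (simp add: enn2real_leI)
  ultimately show ?thesis
    using assms(3) by (auto simp: ennreal_powr_def intro!: ennreal_leI powr_mono2)
qed

text \<open>A Nikolskii inequality. Cauchy--Schwarz on the Fourier side bounds \<open>\<parallel>g\<parallel>\<^sub>\<infinity>\<close> by \<open>sqrt (card F) * \<parallel>g\<parallel>\<^sub>2\<close>,
  and \<open>\<integral>\<bar>g\<bar>\<^sup>p \<le> \<parallel>g\<parallel>\<^sub>\<infinity>\<^bsup>p-2\<^esup> \<parallel>g\<parallel>\<^sub>2\<^sup>2\<close> interpolates between the exponents \<open>2\<close> and \<open>\<infinity>\<close>.\<close>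

lemma trig_poly_Lp_le:
  assumes F: "finite F" and p: "2 \<le> p"
  shows "Lp_norm (ennreal p) (trig_poly F c)
    \<le> ennreal (real (card F) powr (1/2 - 1/p) * sqrt (\<Sum>\<xi>\<in>F. (cmod (c \<xi>))\<^sup>2))"
proof -
  define E where "E = (\<Sum>\<xi>\<in>F. (cmod (c \<xi>))\<^sup>2)"
  define N where "N = real (card F)"
  define g where "g = trig_poly F c"
  have E0: "E \<ge> 0" by (simp add: E_def sum_nonneg)
  have N0: "N \<ge> 0" by (simp add: N_def)
  have cg: "continuous_on UNIV g" unfolding g_def by (rule continuous_trig_poly)
  have sup: "cmod (g x) \<le> sqrt (N * E)" for x
  proof -
    have "cmod (g x) \<le> (\<Sum>\<xi>\<in>F. 1 * cmod (c \<xi>))"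
      unfolding g_def trig_poly_def by (rule order_trans[OF norm_sum]) (simp add: norm_mult)
    then have "(cmod (g x))\<^sup>2 \<le> (\<Sum>\<xi>\<in>F. 1 * cmod (c \<xi>))\<^sup>2"
      by (simp add: power_mono)
    also have "\<dots> \<le> N * E"
      using Cauchy_Schwarz_ineq_sum[of "\<lambda>_. 1" "\<lambda>\<xi>. cmod (c \<xi>)" F] by (simp add: N_def E_def)
    finally show ?thesis by (rule real_le_rsqrt)
  qed
  have i2: "integrable torus_measure (\<lambda>x. (cmod (g x))\<^sup>2)"
    by (intro integrable_torus continuous_intros cg)
  have "(\<integral>\<^sup>+x. ennreal (cmod (g x) powr p) \<partial>torus_measure)
     \<le> (\<integral>\<^sup>+x. ennreal (sqrt (N * E) powr (p - 2) * (cmod (g x))\<^sup>2) \<partial>torus_measure)"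
  proof (intro nn_integral_mono ennreal_leI)
    fix x
    have "cmod (g x) powr p = cmod (g x) powr (p - 2) * (cmod (g x))\<^sup>2"
      using powr_add[of "cmod (g x)" "p - 2" 2] by (simp add: powr_numeral)
    also have "\<dots> \<le> sqrt (N * E) powr (p - 2) * (cmod (g x))\<^sup>2"
      using p by (intro mult_right_mono powr_mono2 sup) auto
    finally show "cmod (g x) powr p \<le> sqrt (N * E) powr (p - 2) * (cmod (g x))\<^sup>2" .
  qed
  also have "\<dots> = ennreal (sqrt (N * E) powr (p - 2) * E)"
    using i2 trig_poly_parseval[OF F, of c]
    by (subst nn_integral_eq_integral) (auto simp: E_def g_def)
  finally have "Lp_norm (ennreal p) g \<le> ennreal ((sqrt (N * E) powr (p - 2) * E) powr (1 / p))"
    using p E0 by (simp add: Lp_norm_def ennreal_powr_le)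
  also have "(sqrt (N * E) powr (p - 2) * E) powr (1 / p) = N powr (1/2 - 1/p) * sqrt E"
  proof (cases "E = 0")
    case False
    with E0 have E: "E > 0" by simp
    have "N \<noteq> 0" using E F by (auto simp: N_def E_def)
    with N0 have N: "N > 0" by simp
    \<comment> \<open>Logarithms turn this identity between monomials in \<open>N\<close> and \<open>E\<close> into a linear one.\<close>
    have "ln ((sqrt (N * E) powr (p - 2) * E) powr (1 / p)) = ln (N powr (1/2 - 1/p) * sqrt E)"
      using E N p by (simp add: ln_mult ln_powr ln_sqrt field_simps)
    then show ?thesis using E N by (subst (asm) ln_inj_iff) auto
  qed simp
  finally show ?thesis unfolding g_def N_def E_def .
qed

text \<open>Blocks decaying like \<open>2\<^bsup>-mt\<^esup>\<close> with \<open>t > r\<close> make the weighted block norms geometrically small, so every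
  summability exponent \<open>q\<close> is admissible.\<close>

lemma besov_norm_le_of_block_decay:
  assumes B: "0 \<le> B" and rt: "r < t" and q: "0 < q"
    and decay: "\<And>m. Lp_norm p (dyadic_block m g) \<le> ennreal (B * 2 powr (- (real m * t)))"
  shows "besov_norm r p \<infinity> g \<le> ennreal B"
    and "besov_norm r p (ennreal q) g \<le> ennreal (B * (1 / (1 - 2 powr ((r - t) * q))) powr (1 / q))"
proof -
  have "ennreal (2 powr (real m * r)) * Lp_norm p (dyadic_block m g) \<le> ennreal B" for m
  proof -
    have "ennreal (2 powr (real m * r)) * Lp_norm p (dyadic_block m g)
       \<le> ennreal (2 powr (real m * r)) * ennreal (B * 2 powr (- (real m * t)))"
      by (intro mult_left_mono decay) auto
    also have "\<dots> = ennreal (B * 2 powr (real m * (r - t)))"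
      using B by (simp add: ennreal_mult[symmetric] powr_add[symmetric] algebra_simps)
    also have "\<dots> \<le> ennreal B"
    proof (rule ennreal_leI)
      have "2 powr (real m * (r - t)) \<le> 2 powr 0"
        using rt by (intro powr_mono) (auto simp: mult_le_0_iff)
      then show "B * 2 powr (real m * (r - t)) \<le> B" using B by (simp add: mult_left_le)
    qed
    finally show ?thesis .
  qed
  then show "besov_norm r p \<infinity> g \<le> ennreal B"
    by (simp add: besov_norm_def SUP_least)
next
  define x where "x = 2 powr ((r - t) * q)"
  have x: "0 < x" "x < 1"
    using rt q by (auto simp: x_def powr_less_one mult_neg_pos)
  have le: "ennreal (2 powr (real m * r * q)) * ennreal_powr (Lp_norm p (dyadic_block m g)) q
      \<le> ennreal (B powr q * x ^ m)" for m
  proof -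
    have "ennreal (2 powr (real m * r * q)) * ennreal_powr (Lp_norm p (dyadic_block m g)) q
       \<le> ennreal (2 powr (real m * r * q)) * ennreal ((B * 2 powr (- (real m * t))) powr q)"
      by (intro mult_left_mono ennreal_powr_le decay) (use B q in auto)
    also have "\<dots> = ennreal (B powr q * x ^ m)"
      using B by (simp add: ennreal_mult[symmetric] powr_mult powr_powr x_def powr_add[symmetric]
          powr_realpow[symmetric] algebra_simps)
    finally show ?thesis .
  qed
  have "(\<Sum>m. ennreal (2 powr (real m * r * q)) * ennreal_powr (Lp_norm p (dyadic_block m g)) q)
      \<le> (\<Sum>m. ennreal (B powr q * x ^ m))"
    by (intro suminf_le le) auto
  also have "\<dots> = ennreal (B powr q * (1 / (1 - x)))"
    using x by (subst suminf_ennreal2) (auto simp: suminf_mult suminf_geometric intro!: summable_mult summable_geometric)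
  finally have "besov_norm r p (ennreal q) g \<le> ennreal ((B powr q * (1 / (1 - x))) powr (1 / q))"
    using q x by (simp add: besov_norm_def ennreal_powr_le)
  also have "(B powr q * (1 / (1 - x))) powr (1 / q) = B * (1 / (1 - x)) powr (1 / q)"
    using B q x by (simp only: powr_mult powr_powr) simp
  finally show "besov_norm r p (ennreal q) g \<le> ennreal (B * (1 / (1 - 2 powr ((r - t) * q))) powr (1 / q))"
    by (simp only: x_def)
qed

text \<open>On the block \<open>m\<close> the symbol has size at most \<open>C 2\<^bsup>-m\<rho>\<^esup>\<close>, so the multiplier gains this factor in \<open>L\<^sup>2\<close>.
  Passing from \<open>L\<^sup>2\<close> to \<open>L\<^sup>p\<close> costs the power \<open>1/2 - 1/p\<close> of the number of frequencies in the block.\<close>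

lemma Op_block_Lp_le:
  assumes \<rho>: "0 \<le> \<rho>" and p: "2 \<le> p" and C: "C > 0" "\<And>\<xi>. \<xi> \<noteq> 0 \<Longrightarrow> cmod (\<sigma> \<xi>) \<le> C * \<bar>of_int \<xi>\<bar> powr (- \<rho>)"
    and f: "f \<in> smooth_torus" and B: "0 \<le> B"
    and energy: "(\<Sum>\<xi>\<in>freq_block m. (cmod (fourier_coeff f \<xi>))\<^sup>2) \<le> (B * 2 powr (- (real m * s)))\<^sup>2"
  shows "Lp_norm (ennreal p) (dyadic_block m (Op \<sigma> f))
    \<le> ennreal (2 * C * B * 2 powr (- (real m * (s + \<rho> - 1/2 + 1/p))))"
proof -
  have rc: "rho_condition \<rho> \<sigma>" using C unfolding rho_condition_def by blast
  define D where "D = C * 2 powr (- (real m * \<rho>))"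
  have D: "D \<ge> 0" using C by (simp add: D_def)
  have \<sigma>: "cmod (\<sigma> \<xi>) \<le> D" if "\<xi> \<in> freq_block m" for \<xi>
  proof -
    from that have le: "2 ^ m \<le> \<bar>\<xi>\<bar>" by (simp add: freq_block_def)
    then have "\<xi> \<noteq> 0" by auto
    from le have "2 powr real m \<le> \<bar>of_int \<xi> :: real\<bar>"
      unfolding powr_realpow[OF zero_less_numeral] by (metis of_int_abs of_int_le_iff of_int_numeral of_int_power)
    then have "\<bar>of_int \<xi>\<bar> powr (- \<rho>) \<le> (2 powr real m) powr (- \<rho>)"
      by (intro powr_mono2') (use \<rho> in auto)
    then have "C * \<bar>of_int \<xi>\<bar> powr (- \<rho>) \<le> D"
      using C(1) by (simp add: D_def powr_powr)
    with C(2)[OF \<open>\<xi> \<noteq> 0\<close>] show ?thesis by simp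
  qed
  have "(\<Sum>\<xi>\<in>freq_block m. (cmod (fourier_coeff (Op \<sigma> f) \<xi>))\<^sup>2)
      \<le> (\<Sum>\<xi>\<in>freq_block m. D\<^sup>2 * (cmod (fourier_coeff f \<xi>))\<^sup>2)"
    using \<sigma> by (intro sum_mono) (simp add: fourier_coeff_Op[OF rc \<rho> f] norm_mult power_mult_distrib mult_right_mono power_mono)
  also have "\<dots> \<le> D\<^sup>2 * (B * 2 powr (- (real m * s)))\<^sup>2"
    unfolding sum_distrib_left[symmetric] by (intro mult_left_mono energy) auto
  finally have "sqrt (\<Sum>\<xi>\<in>freq_block m. (cmod (fourier_coeff (Op \<sigma> f) \<xi>))\<^sup>2) \<le> D * (B * 2 powr (- (real m * s)))"
    unfolding power_mult_distrib[symmetric] using D B by (intro real_le_lsqrt) auto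
  moreover have "real (card (freq_block m)) powr (1/2 - 1/p) \<le> 2 * 2 powr (real m * (1/2 - 1/p))"
  proof -
    have "real (card (freq_block m)) powr (1/2 - 1/p) \<le> (2 powr (real m + 1)) powr (1/2 - 1/p)"
      using p card_freq_block_le[of m]
      by (intro powr_mono2) (auto simp: powr_add powr_realpow field_simps)
    also have "\<dots> = 2 powr (1/2 - 1/p) * 2 powr (real m * (1/2 - 1/p))"
      unfolding powr_powr powr_add[symmetric] by (simp only: distrib_right mult_1 add.commute)
    also have "\<dots> \<le> 2 powr 1 * 2 powr (real m * (1/2 - 1/p))"
      using p by (intro mult_right_mono powr_mono) (auto simp: field_simps)
    finally show ?thesis by simp
  qed
  ultimately have "real (card (freq_block m)) powr (1/2 - 1/p) * sqrt (\<Sum>\<xi>\<in>freq_block m. (cmod (fourier_coeff (Op \<sigma> f) \<xi>))\<^sup>2)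
     \<le> (2 * 2 powr (real m * (1/2 - 1/p))) * (D * (B * 2 powr (- (real m * s))))"
    by (intro mult_mono) (auto intro: sum_nonneg)
  also have "\<dots> = 2 * C * B * (2 powr (real m * (1/2 - 1/p)) * 2 powr (- (real m * \<rho>)) * 2 powr (- (real m * s)))"
    by (simp add: D_def)
  also have "2 powr (real m * (1/2 - 1/p)) * 2 powr (- (real m * \<rho>)) * 2 powr (- (real m * s))
      = 2 powr (- (real m * (s + \<rho> - 1/2 + 1/p)))"
    unfolding powr_add[symmetric] by (simp add: algebra_simps)
  finally show ?thesis
    unfolding dyadic_block_eq_trig_poly
    by (intro order_trans[OF trig_poly_Lp_le[OF finite_freq_block p]] ennreal_leI)
qed

section \<open>Two norms that control the energy of the blocks\<close>

text \<open>Isolates what the Besov and the Hoelder norm share, so that one estimate serves both. The factor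
  \<open>2\<close> leaves room for the constant \<open>(\<pi>/2)\<^bsup>s\<^esup>\<close> of the Hoelder norm.\<close>

definition block_energy_control :: "real \<Rightarrow> ((real \<Rightarrow> complex) \<Rightarrow> ennreal) \<Rightarrow> bool" where
  "block_energy_control s N \<longleftrightarrow>
     (\<forall>f\<in>smooth_torus. \<forall>A m. 0 \<le> A \<longrightarrow> N f \<le> ennreal A \<longrightarrow>
        (\<Sum>\<xi>\<in>freq_block m. (cmod (fourier_coeff f \<xi>))\<^sup>2) \<le> (2 * A * 2 powr (- (real m * s)))\<^sup>2)"

text \<open>On a probability space the \<open>L\<^sup>2\<close> norm of a block is at most its essential supremum.\<close>

lemma block_energy_control_besov: "block_energy_control s (besov_norm s \<infinity> \<infinity>)"
  unfolding block_energy_control_def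
proof (intro ballI allI impI)
  fix f A m assume A: "0 \<le> A" and N: "besov_norm s \<infinity> \<infinity> f \<le> ennreal A"
  define g where "g = dyadic_block m f"
  define e where "e = esssup torus_measure (\<lambda>x. ennreal (cmod (g x)))"
  have cg: "continuous_on UNIV g"
    unfolding g_def dyadic_block_eq_trig_poly by (rule continuous_trig_poly)
  have "ennreal (2 powr (real m * s)) * e \<le> besov_norm s \<infinity> \<infinity> f"
    unfolding besov_norm_def e_def g_def Lp_norm_def by (auto intro!: SUP_upper)
  with N have e: "ennreal (2 powr (real m * s)) * e \<le> ennreal A" by simp
  have "AE x in torus_measure. ennreal (cmod (g x)) \<le> e"
    unfolding e_def by (rule esssup_AE)
  then have "AE x in torus_measure. (cmod (g x))\<^sup>2 \<le> (A * 2 powr (- (real m * s)))\<^sup>2"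
  proof eventually_elim
    case (elim x)
    have "ennreal (2 powr (real m * s) * cmod (g x)) \<le> ennreal (2 powr (real m * s)) * e"
      using elim by (simp add: ennreal_mult mult_left_mono)
    with e have "ennreal (2 powr (real m * s) * cmod (g x)) \<le> ennreal A" by simp
    then have "2 powr (real m * s) * cmod (g x) \<le> A" using A by simp
    then have "cmod (g x) \<le> A * 2 powr (- (real m * s))"
      by (simp add: powr_minus field_simps)
    then show ?case by (simp add: power_mono)
  qed
  then have "(\<integral>x. (cmod (g x))\<^sup>2 \<partial>torus_measure) \<le> (\<integral>x. (A * 2 powr (- (real m * s)))\<^sup>2 \<partial>torus_measure)"
    by (intro integral_mono_AE integrable_torus continuous_intros cg)
  also have "\<dots> = (A * 2 powr (- (real m * s)))\<^sup>2"
    by (simp add: torus.prob_space[simplified])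
  also have "\<dots> \<le> (2 * A * 2 powr (- (real m * s)))\<^sup>2"
    using A by (intro power_mono) auto
  finally show "(\<Sum>\<xi>\<in>freq_block m. (cmod (fourier_coeff f \<xi>))\<^sup>2) \<le> (2 * A * 2 powr (- (real m * s)))\<^sup>2"
    unfolding g_def dyadic_block_eq_trig_poly trig_poly_parseval[OF finite_freq_block] .
qed

lemma hoelder_norm_increment:
  assumes "hoelder_norm s f \<le> ennreal A" "0 \<le> A" "y \<noteq> 0"
  shows "cmod (f (x - y) - f x) \<le> A * \<bar>y\<bar> powr s"
proof -
  have "ennreal (cmod (f (x - y) - f x) / \<bar>y\<bar> powr s)
      \<le> (SUP x. SUP y\<in>-{0}. ennreal (cmod (f (x - y) - f x) / \<bar>y\<bar> powr s))"
    using assms(3) by (intro SUP_upper2[of x] SUP_upper2[of y]) auto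
  also have "\<dots> \<le> hoelder_norm s f" by (simp add: hoelder_norm_def)
  finally have "ennreal (cmod (f (x - y) - f x) / \<bar>y\<bar> powr s) \<le> ennreal A"
    using assms(1) by simp
  then have "cmod (f (x - y) - f x) / \<bar>y\<bar> powr s \<le> A" using assms(2) by simp
  then show ?thesis using assms(3) by (simp add: field_simps)
qed

lemma norm_cis_minus_1_ge:
  assumes "pi / 2 \<le> \<bar>\<theta>\<bar>" "\<bar>\<theta>\<bar> \<le> pi"
  shows "1 \<le> cmod (cis \<theta> - 1)"
proof -
  have "cos \<bar>\<theta>\<bar> \<le> cos (pi / 2)"
    using assms by (intro cos_monotone_0_pi_le) auto
  then have "1 \<le> \<bar>Re (cis \<theta> - 1)\<bar>" by simp
  also have "\<dots> \<le> cmod (cis \<theta> - 1)" by (rule abs_Re_le_cmod)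
  finally show ?thesis .
qed

text \<open>Sharp frequency cutoffs are not bounded on \<open>L\<^sup>\<infinity>\<close>, so the blocks of a Hoelder function are estimated
  directly in \<open>L\<^sup>2\<close>. The increment \<open>g x = f (x - h) - f x\<close> has the coefficients of \<open>f\<close> multiplied by
  \<open>cis (- h \<xi>) - 1\<close>. With \<open>h = \<pi> / 2\<^bsup>m+1\<^esup>\<close> the angle \<open>h \<bar>\<xi>\<bar>\<close> lies in \<open>[\<pi>/2, \<pi>]\<close> throughout the block \<open>m\<close>,
  where this factor has modulus at least \<open>1\<close>. Bessel's inequality for \<open>g\<close>, which is of size \<open>h\<^sup>s\<close>, then bounds
  the energy of the block.\<close>

lemma block_energy_control_hoelder:
  assumes s: "0 < s" "s < 1"
  shows "block_energy_control s (hoelder_norm s)"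
  unfolding block_energy_control_def
proof (intro ballI allI impI)
  fix f A m assume f: "f \<in> smooth_torus" and A: "0 \<le> A" and N: "hoelder_norm s f \<le> ennreal A"
  define h where "h = pi / 2 ^ Suc m"
  have "(1::real) \<le> 4 * 2 ^ m" using one_le_power[of "2::real" m] by linarith
  then have h: "0 < h" "h \<le> 2 * pi" by (auto simp: h_def field_simps)
  define g where "g x = f (x - h) - f x" for x
  have cf: "continuous_on UNIV f" using f by (rule continuous_smooth_torus)
  have cfh: "continuous_on UNIV (\<lambda>x. f (x - h))"
    by (intro continuous_on_compose2[OF cf] continuous_intros) auto
  have cg: "continuous_on UNIV g" unfolding g_def by (intro continuous_intros cf cfh)
  have coeff: "fourier_coeff g \<xi> = (cis (- (h * of_int \<xi>)) - 1) * fourier_coeff f \<xi>" for \<xi>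
    unfolding g_def fourier_coeff_diff[OF cfh cf]
    using fourier_coeff_shift[OF cf periodic_smooth_torus[OF f], of h \<xi>] h by (simp add: algebra_simps)
  have le: "cmod (fourier_coeff f \<xi>) \<le> cmod (fourier_coeff g \<xi>)" if "\<xi> \<in> freq_block m" for \<xi>
  proof -
    from that have \<xi>: "2 ^ m \<le> \<bar>\<xi>\<bar>" "\<bar>\<xi>\<bar> \<le> 2 ^ Suc m" by (auto simp: freq_block_def)
    have \<xi>': "(2::real) ^ m \<le> \<bar>of_int \<xi>\<bar>" "\<bar>of_int \<xi>\<bar> \<le> (2::real) ^ Suc m"
      using \<xi>[THEN of_int_le_iff[where ?'a = real, THEN iffD2]] by auto
    have "h * 2 ^ m = pi / 2" "h * 2 ^ Suc m = pi" by (auto simp: h_def)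
    with mult_left_mono[OF \<xi>'(1) less_imp_le[OF h(1)]] mult_left_mono[OF \<xi>'(2) less_imp_le[OF h(1)]]
    have "pi / 2 \<le> h * \<bar>of_int \<xi>\<bar>" "h * \<bar>of_int \<xi>\<bar> \<le> pi" by linarith+
    with h have "1 \<le> cmod (cis (- (h * of_int \<xi>)) - 1)"
      by (intro norm_cis_minus_1_ge) (auto simp: abs_mult)
    from mult_right_mono[OF this, of "cmod (fourier_coeff f \<xi>)"] show ?thesis
      by (simp add: coeff norm_mult)
  qed
  have gb: "cmod (g x) \<le> 2 * A * 2 powr (- (real m * s))" for x
  proof -
    have "h = (pi / 2) * 2 powr (- real m)"
      by (simp add: h_def powr_minus powr_realpow field_simps)
    then have "h powr s = ((pi / 2) * 2 powr (- real m)) powr s"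
      by (rule arg_cong)
    also have "\<dots> = (pi / 2) powr s * 2 powr (- (real m * s))"
      by (subst powr_mult) (auto simp: powr_powr)
    also have "\<dots> \<le> 2 * 2 powr (- (real m * s))"
    proof (rule mult_right_mono)
      have "(pi / 2) powr s \<le> (pi / 2) powr 1"
        using s pi_ge_two by (intro powr_mono) auto
      also have "\<dots> \<le> 2" using pi_less_4 by simp
      finally show "(pi / 2) powr s \<le> 2" .
    qed simp
    finally have "A * h powr s \<le> A * (2 * 2 powr (- (real m * s)))"
      by (intro mult_left_mono A)
    then show ?thesis
      using hoelder_norm_increment[OF N A, of h x] h by (simp add: g_def)
  qed
  have "(\<Sum>\<xi>\<in>freq_block m. (cmod (fourier_coeff f \<xi>))\<^sup>2) \<le> (\<Sum>\<xi>\<in>freq_block m. (cmod (fourier_coeff g \<xi>))\<^sup>2)"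
    by (intro sum_mono power_mono le) auto
  also have "\<dots> \<le> (\<integral>x. (cmod (g x))\<^sup>2 \<partial>torus_measure)"
    by (intro bessel_inequality cg) simp
  also have "\<dots> \<le> (\<integral>x. (2 * A * 2 powr (- (real m * s)))\<^sup>2 \<partial>torus_measure)"
    by (intro integral_mono integrable_torus continuous_intros cg power_mono gb) auto
  also have "\<dots> = (2 * A * 2 powr (- (real m * s)))\<^sup>2"
    by (simp add: torus.prob_space[simplified])
  finally show "(\<Sum>\<xi>\<in>freq_block m. (cmod (fourier_coeff f \<xi>))\<^sup>2) \<le> (2 * A * 2 powr (- (real m * s)))\<^sup>2" .
qed

section \<open>Boundedness of the multiplier\<close>

lemma bounded_linear_into_besov_Op:
  assumes \<rho>: "0 \<le> \<rho>" and \<sigma>: "rho_condition \<rho> \<sigma>" and p: "2 \<le> p" and q: "0 < q"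
    and N: "block_energy_control s N" and r: "r < s + \<rho> - 1/2 + 1/p"
  shows "bounded_linear_into N (besov_norm r (ennreal p) (ennreal q)) (Op \<sigma>)"
    and "bounded_linear_into N (besov_norm r (ennreal p) \<infinity>) (Op \<sigma>)"
proof -
  from \<sigma> obtain C where C: "C > 0" "\<And>\<xi>. \<xi> \<noteq> 0 \<Longrightarrow> cmod (\<sigma> \<xi>) \<le> C * \<bar>of_int \<xi>\<bar> powr (- \<rho>)"
    unfolding rho_condition_def by blast
  define t where "t = s + \<rho> - 1/2 + 1/p"
  define K where "K = (1 / (1 - 2 powr ((r - t) * q))) powr (1 / q)"
  have "2 powr ((r - t) * q) < 1"
    using r q by (auto simp: t_def powr_less_one mult_neg_pos)
  then have K: "K > 0" using r q by (auto simp: K_def t_def)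
  have block: "Lp_norm (ennreal p) (dyadic_block m (Op \<sigma> f)) \<le> ennreal (4 * C * A * 2 powr (- (real m * t)))"
    if "f \<in> smooth_torus" "N f = ennreal A" "0 \<le> A" for f A m
  proof -
    have "(\<Sum>\<xi>\<in>freq_block m. (cmod (fourier_coeff f \<xi>))\<^sup>2) \<le> (2 * A * 2 powr (- (real m * s)))\<^sup>2"
      using N that unfolding block_energy_control_def by simp
    from Op_block_Lp_le[OF \<rho> p C that(1) _ this] that(3) show ?thesis
      by (simp add: t_def mult.assoc)
  qed
  have bnd: "bounded_linear_into N M (Op \<sigma>)"
    if "L > 0" and le: "\<And>f A. f \<in> smooth_torus \<Longrightarrow> N f = ennreal A \<Longrightarrow> 0 \<le> A \<Longrightarrow> M (Op \<sigma> f) \<le> ennreal (L * A)" for M L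
    unfolding bounded_linear_into_def
  proof (intro conjI exI[of _ L] ballI linear_on_smooth_Op[OF \<sigma> \<rho>] that(1))
    fix f assume f: "f \<in> smooth_torus"
    show "M (Op \<sigma> f) \<le> ennreal L * N f"
    proof (cases "N f")
      case (real A)
      with le[OF f, of A] \<open>L > 0\<close> show ?thesis by (simp add: ennreal_mult)
    next
      case top
      with \<open>L > 0\<close> show ?thesis by (simp add: ennreal_mult_top)
    qed
  qed
  have rt: "r < t" using r by (simp add: t_def)
  show "bounded_linear_into N (besov_norm r (ennreal p) (ennreal q)) (Op \<sigma>)"
  proof (rule bnd[of "4 * C * K"])
    fix f A assume "f \<in> smooth_torus" "N f = ennreal A" "0 \<le> A"
    from besov_norm_le_of_block_decay(2)[OF _ rt q block[OF this]] C \<open>0 \<le> A\<close>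
    show "besov_norm r (ennreal p) (ennreal q) (Op \<sigma> f) \<le> ennreal (4 * C * K * A)"
      by (simp add: K_def mult_ac)
  qed (use C K in simp)
  show "bounded_linear_into N (besov_norm r (ennreal p) \<infinity>) (Op \<sigma>)"
  proof (rule bnd[of "4 * C"])
    fix f A assume "f \<in> smooth_torus" "N f = ennreal A" "0 \<le> A"
    from besov_norm_le_of_block_decay(1)[OF _ rt q block[OF this]] C \<open>0 \<le> A\<close>
    show "besov_norm r (ennreal p) \<infinity> (Op \<sigma> f) \<le> ennreal (4 * C * A)" by simp
  qed (use C in simp)
qed

theorem theorem3p5:
  fixes s p q r \<rho> :: real and \<sigma> :: "int \<Rightarrow> complex"
  assumes "0 < s" "s < 1" and "2 \<le> p" and "0 < q" and "0 \<le> \<rho>" "\<rho> \<le> 1"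
    and "rho_condition \<rho> \<sigma>"
  shows "(r + 1 - 2 / p < \<rho> \<longrightarrow>
           bounded_linear_into (besov_norm s \<infinity> \<infinity>) (besov_norm r (ennreal p) (ennreal q)) (Op \<sigma>) \<and>
           bounded_linear_into (hoelder_norm s) (besov_norm r (ennreal p) (ennreal q)) (Op \<sigma>)) \<and>
         (r + 1 - 2 / p \<le> \<rho> \<longrightarrow>
           bounded_linear_into (besov_norm s \<infinity> \<infinity>) (besov_norm r (ennreal p) \<infinity>) (Op \<sigma>) \<and>
           bounded_linear_into (hoelder_norm s) (besov_norm r (ennreal p) \<infinity>) (Op \<sigma>))"
proof -
  have "r < s + \<rho> - 1/2 + 1/p" if "r + 1 - 2 / p \<le> \<rho>"
  proof -
    \<comment> \<open>The loss \<open>1/2 - 1/p\<close> is half of \<open>1 - 2/p\<close>, and the smoothness \<open>s > 0\<close> makes the inequality strict.\<close>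
    have "1 / p \<le> 1 / 2" using assms(3) by (simp add: field_simps)
    moreover have "2 / p = 2 * (1 / p)" by simp
    ultimately show ?thesis using that assms(1) by linarith
  qed
  then show ?thesis
    using bounded_linear_into_besov_Op[OF assms(5,7,3,4) block_energy_control_besov]
      bounded_linear_into_besov_Op[OF assms(5,7,3,4) block_energy_control_hoelder[OF assms(1,2)]]
    by auto
qed

end
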